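(* Let $n\ge 1$ and let $\pi_n\in\mathcal{S}_n$ be any permutation. For $(k,\ell)\in\{1,\dots,n+1\}^2$ let $\pi_{n+1}^{(k,\ell)}\in\mathcal{S}_{n+1}$ be the permutation obtained from $\pi_n$ by insertion at $(k,\ell)$ (defined in the context). For $a,b\in\{0,1\}$ define $$N_{n+1}(a,b,\pi_n)=\mathrm{Card}\Big\{(k,\ell)\in\{1,\dots,n+1\}^2 \;:\; D\big(\pi_{n+1}^{(k,\ell)}\big)-D(\pi_n)=a,\ D\big((\pi_{n+1}^{(k,\ell)})^{-1}\big)-D(\pi_n^{-1})=b\Big\}.$$ Writing $D_n=D(\pi_n)$ and $D'_n=D(\pi_n^{-1})$, we have $$N_{n+1}(a,b,\pi_n)=\begin{cases}(n-D_n)(n-D'_n)+n & \text{if } (a,b)=(1,1),\\ (n-D_n)(D'_n+1)-n & \text{if } (a,b)=(1,0),\\ (D_n+1)(n-D'_n)-n & \text{if } (a,b)=(0,1),\\ (D_n+1)(D'_n+1)+n & \text{if } (a,b)=(0,0).\end{cases}$$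
   Context: $\mathcal{S}_n$ is the symmetric group on $\{1,\dots,n\}$. For $\sigma\in\mathcal{S}_m$, $D(\sigma)=\#\{i\in\{1,\dots,m-1\}:\sigma(i)>\sigma(i+1)\}$ is its number of descents. Insertion at $(k,\ell)$: given $\pi_n\in\mathcal{S}_n$ and $(k,\ell)\in\{1,\dots,n+1\}^2$, define $\pi_{n+1}=\pi^{(k,\ell)}_{n+1}\in\mathcal{S}_{n+1}$ by $\pi_{n+1}(k)=\ell$; for $i<k$, $\pi_{n+1}(i)=\pi_n(i)$ if $\pi_n(i)<\ell$ and $\pi_{n+1}(i)=\pi_n(i)+1$ if $\pi_n(i)\ge\ell$; for $i>k$, $\pi_{n+1}(i)=\pi_n(i-1)$ if $\pi_n(i-1)<\ell$ and $\pi_{n+1}(i)=\pi_n(i-1)+1$ if $\pi_n(i-1)\ge \ell$. (Geometrically: $\pi_n$ is drawn as the points $(i/(n+1),\pi_n(i)/(n+1))$ in $[0,1]^2$, a point $u$ is placed in the open cell $](k-1)/(n+1),k/(n+1)[\times](\ell-1)/(n+1),\ell/(n+1)[$, and the new point is inserted there with relative orders preserved.) *)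

theory Defs
  imports "HOL-Combinatorics.Permutations"
begin

text \<open>
  Elements of $\mathcal{S}_n$ are the functions \<open>\<sigma> :: nat \<Rightarrow> nat\<close> with \<open>\<sigma> permutes {1..n}\<close>;
  the inverse in $\mathcal{S}_n$ is then \<open>inv \<sigma>\<close>.
\<close>

definition descents :: "nat \<Rightarrow> (nat \<Rightarrow> nat) \<Rightarrow> nat" where
  "descents m \<sigma> = card {i \<in> {1..m - 1}. \<sigma> i > \<sigma> (i + 1)}"

text \<open>
  No case distinction is needed outside \<open>{1..n+1}\<close>: if \<open>\<pi>\<close> fixes every point outside \<open>{1..n}\<close>
  and \<open>k, l \<in> {1..n+1}\<close>, the formula below fixes every point outside \<open>{1..n+1}\<close>.
\<close>

definition insertion :: "nat \<Rightarrow> nat \<Rightarrow> (nat \<Rightarrow> nat) \<Rightarrow> nat \<Rightarrow> nat" where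
  "insertion k l \<pi> i =
     (if i = k then l
      else if i < k then (if \<pi> i < l then \<pi> i else \<pi> i + 1)
      else (if \<pi> (i - 1) < l then \<pi> (i - 1) else \<pi> (i - 1) + 1))"

definition insertion_count :: "nat \<Rightarrow> int \<Rightarrow> int \<Rightarrow> (nat \<Rightarrow> nat) \<Rightarrow> nat" where
  "insertion_count n a b \<pi> =
     card {(k, l) \<in> {1..n + 1} \<times> {1..n + 1}.
             int (descents (n + 1) (insertion k l \<pi>)) - int (descents n \<pi>) = a \<and>
             int (descents (n + 1) (inv (insertion k l \<pi>))) - int (descents n (inv \<pi>)) = b}"

lemma insertion_permutes:
  assumes p: "\<pi> permutes {1..n}" and k: "k \<in> {1..n + 1}" and l: "l \<in> {1..n + 1}"
  shows "insertion k l \<pi> permutes {1..n + 1}"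
proof (rule bij_imp_permutes)
  have mem: "\<pi> i \<in> {1..n}" if "i \<in> {1..n}" for i
    using permutes_in_image[OF p] that by blast
  have inj: "\<pi> i = \<pi> j \<longleftrightarrow> i = j" for i j
    using permutes_inj[OF p] by (auto dest: injD)
  have "inj_on (insertion k l \<pi>) {1..n + 1}"
  proof (rule inj_onI)
    fix i j
    assume eq: "insertion k l \<pi> i = insertion k l \<pi> j"
    define s where "s i = (if i < k then i else i - 1)" for i
    have s: "insertion k l \<pi> i = (if i = k then l else if \<pi> (s i) < l then \<pi> (s i) else \<pi> (s i) + 1)" for i
      by (simp add: insertion_def s_def)
    have "i = k \<longleftrightarrow> j = k"
      using eq unfolding s by (auto split: if_splits)
    moreover have "s i = s j" if "i \<noteq> k" "j \<noteq> k"
      using eq that unfolding s by (auto split: if_splits simp: inj)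
    ultimately show "i = j"
      by (cases "i = k") (auto simp: s_def split: if_splits)
  qed
  moreover have "insertion k l \<pi> ` {1..n + 1} \<subseteq> {1..n + 1}"
  proof safe
    fix i assume i: "i \<in> {1..n + 1}"
    show "insertion k l \<pi> i \<in> {1..n + 1}"
    proof (cases "i > k")
      case True
      then have "i - 1 \<in> {1..n}" using k i by auto
      then show ?thesis using True k l mem[of "i - 1"] by (auto simp: insertion_def)
    next
      case False
      then show ?thesis using k l i mem[of i] by (auto simp: insertion_def)
    qed
  qed
  ultimately show "bij_betw (insertion k l \<pi>) {1..n + 1} {1..n + 1}"
    by (simp add: bij_betw_def endo_inj_surj)
next
  fix i assume i: "i \<notin> {1..n + 1}"
  then have "\<pi> i = i" "\<pi> (i - 1) = i - 1"
    using p by (auto intro!: permutes_not_in)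
  then show "insertion k l \<pi> i = i"
    using i k l by (auto simp: insertion_def)
qed

end

theory Submission
  imports Defs
begin

text \<open>
  A permutation of \<open>{1..n}\<close> fixes \<open>0\<close> and \<open>n + 1\<close>, so that no boundary cases arise. With
  \<open>d\<^sub>j = [\<pi> j > \<pi> (j + 1)]\<close>, inserting at cell \<open>(j + 1, m + 1)\<close> changes the number of descents of
  \<open>\<pi>\<close> by \<open>X(j, m) = (1 - d\<^sub>j) - ([m < \<pi> (j + 1)] - [m < \<pi> j]) \<in> {0, 1}\<close>. The inverse of the new
  permutation is an insertion into the inverse at the transposed cell, so the other change
  \<open>Y(j, m)\<close> has the same shape. The differences telescope, which gives the sums of \<open>X\<close> and \<open>Y\<close>
  over all cells and reduces the sum of \<open>X Y\<close> to that of the product of the two differences; for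
  fixed \<open>j\<close> the latter telescopes once more over \<open>m < \<pi> (j + 1)\<close> and over \<open>m < \<pi> j\<close>, and
  contributes exactly \<open>1\<close>.
\<close>

lemma inv_insertion:
  assumes "bij \<pi>"
  shows "inv (insertion k l \<pi>) = insertion l k (inv \<pi>)"
proof (rule inv_unique_comp)
  \<comment> \<open>One identity serves both compositions: it is applied to \<open>\<pi>\<close> and
    then to \<open>inv \<pi>\<close>.\<close>
  have *: "insertion l' k' (inv \<rho>) (insertion k' l' \<rho> i) = i" if "bij \<rho>" for \<rho> :: "nat \<Rightarrow> nat" and k' l' i
    using inv_f_f[OF bij_is_inj[OF that]] by (auto simp: insertion_def)
  show "insertion l k (inv \<pi>) \<circ> insertion k l \<pi> = id"
    using *[OF assms] by (simp add: fun_eq_iff)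
  show "insertion k l \<pi> \<circ> insertion l k (inv \<pi>) = id"
    using *[OF bij_imp_bij_inv[OF assms]] by (simp add: fun_eq_iff inv_inv_eq[OF assms])
qed

text \<open>The border indices \<open>0\<close> and \<open>m\<close> contribute nothing, since
  \<open>\<sigma> 0 = 0\<close> and \<open>\<sigma> m \<le> m < \<sigma> (Suc m)\<close>.\<close>

lemma descents_eq_sum:
  assumes "\<sigma> permutes {1..m}"
  shows "int (descents m \<sigma>) = (\<Sum>i\<le>m. of_bool (\<sigma> i > \<sigma> (Suc i)))"
proof -
  have "\<sigma> 0 = 0" "\<sigma> (Suc m) = Suc m" "\<sigma> m \<le> m"
    using assms permutes_not_in[OF assms] permutes_in_image[OF assms, of m] by (cases m; auto)+
  then have "i \<noteq> 0 \<and> i \<noteq> m" if "\<sigma> i > \<sigma> (Suc i)" for i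
    using that by (metis le_SucI not_less not_less0)
  then have "{i \<in> {..m}. \<sigma> i > \<sigma> (Suc i)} = {i \<in> {1..m - 1}. \<sigma> i > \<sigma> (i + 1)}"
    by fastforce
  then show ?thesis
    by (simp add: descents_def Int_def)
qed

text \<open>Cells are numbered from 0: \<open>(j, m)\<close> stands for insertion at
  \<open>(Suc j, Suc m)\<close>. The last bracket is kept apart because it telescopes over
  \<open>j\<close>.\<close>

definition descent_gain :: "(nat \<Rightarrow> nat) \<Rightarrow> nat \<Rightarrow> nat \<Rightarrow> int" where
  "descent_gain \<pi> j m =
     1 - of_bool (\<pi> j > \<pi> (Suc j)) - (of_bool (m < \<pi> (Suc j)) - of_bool (m < \<pi> j))"

text \<open>The step of the indicator is 0 or -1 at a descent and 0 or 1 elsewhere.\<close>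

lemma descent_gain_cases: "descent_gain \<pi> j m = 0 \<or> descent_gain \<pi> j m = 1"
  by (auto simp: descent_gain_def)

text \<open>Every adjacent comparison except the one at \<open>j\<close> survives, shifted by one to
  the right of the new point. The comparison at \<open>j\<close> gives way to two with the new value
  \<open>Suc m\<close>: a descent into it iff \<open>m < \<pi> j\<close>, and a descent out of it
  iff not \<open>m < \<pi> (Suc j)\<close>.\<close>

lemma descents_insertion:
  assumes p: "\<pi> permutes {1..n}" and j: "j \<le> n" and m: "m \<le> n"
  shows "int (descents (n + 1) (insertion (Suc j) (Suc m) \<pi>)) - int (descents n \<pi>)
           = descent_gain \<pi> j m"
proof -
  define \<tau> where "\<tau> = insertion (Suc j) (Suc m) \<pi>"
  define f where "f i = (of_bool (\<pi> i > \<pi> (Suc i)) :: int)" for i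
  define g where "g i = (of_bool (\<tau> i > \<tau> (Suc i)) :: int)" for i
  have split: "{..<n + 2} = {..<j} \<union> {j, Suc j} \<union> {Suc (Suc j)..<Suc (n + 1)}"
    using j by auto
  have "(\<Sum>i<n + 2. g i) = (\<Sum>i<j. g i) + (g j + g (Suc j)) + (\<Sum>i=Suc j..<n + 1. g (Suc i))"
    unfolding split sum.shift_bounds_Suc_ivl[symmetric]
    by (subst sum.union_disjoint; (subst sum.union_disjoint)?) auto
  also have "(\<Sum>i<j. g i) = (\<Sum>i<j. f i)"
    by (rule sum.cong) (auto simp: f_def g_def \<tau>_def insertion_def)
  also have "(\<Sum>i=Suc j..<n + 1. g (Suc i)) = (\<Sum>i=Suc j..<n + 1. f i)"
    by (rule sum.cong) (auto simp: f_def g_def \<tau>_def insertion_def)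
  also have "g j = of_bool (m < \<pi> j)"
    by (auto simp: g_def \<tau>_def insertion_def)
  also have "g (Suc j) = 1 - of_bool (m < \<pi> (Suc j))"
    by (auto simp: g_def \<tau>_def insertion_def)
  finally have "(\<Sum>i<n + 2. g i) = (\<Sum>i<j. f i) + (\<Sum>i=Suc j..<n + 1. f i)
                  + of_bool (m < \<pi> j) + 1 - of_bool (m < \<pi> (Suc j))"
    by simp
  moreover have "(\<Sum>i<n + 1. f i) = (\<Sum>i<j. f i) + f j + (\<Sum>i=Suc j..<n + 1. f i)"
  proof -
    have split: "{..<n + 1} = {..<j} \<union> {j} \<union> {Suc j..<n + 1}"
      using j by auto
    show ?thesis
      unfolding split by (subst sum.union_disjoint; (subst sum.union_disjoint)?) auto
  qed
  moreover have "int (descents (n + 1) \<tau>) = (\<Sum>i<n + 2. g i)"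
    using descents_eq_sum[OF insertion_permutes[OF p, of "Suc j" "Suc m"]] j m
    by (simp add: g_def \<tau>_def lessThan_Suc_atMost)
  moreover have "int (descents n \<pi>) = (\<Sum>i<n + 1. f i)"
    using descents_eq_sum[OF p] by (simp add: f_def lessThan_Suc_atMost)
  ultimately show ?thesis
    by (simp add: \<tau>_def f_def descent_gain_def)
qed

lemma insertion_count_eq_sum:
  assumes p: "\<pi> permutes {1..n}"
  shows "int (insertion_count n a b \<pi>) =
    (\<Sum>j\<le>n. \<Sum>m\<le>n. of_bool (descent_gain \<pi> j m = a \<and> descent_gain (inv \<pi>) m j = b))"
proof -
  define C where "C = {(j, m) \<in> {..n} \<times> {..n}. descent_gain \<pi> j m = a \<and> descent_gain (inv \<pi>) m j = b}"
  have gain: "int (descents (n + 1) (insertion (Suc j) (Suc m) \<pi>)) - int (descents n \<pi>) = descent_gain \<pi> j m"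
       "int (descents (n + 1) (inv (insertion (Suc j) (Suc m) \<pi>))) - int (descents n (inv \<pi>))
           = descent_gain (inv \<pi>) m j" if "j \<le> n" "m \<le> n" for j m
    using that descents_insertion[OF p] descents_insertion[OF permutes_inv[OF p]]
    by (simp_all add: inv_insertion[OF permutes_bij[OF p]])
  \<comment> \<open>Shifting both coordinates by one is a bijection from the cells counted from 0 to
    those counted from 1.\<close>
  have cells: "{1..n + 1} \<times> {1..n + 1} = map_prod Suc Suc ` ({..n} \<times> {..n})"
    by (simp add: map_prod_surj_on[OF refl refl] atMost_atLeast0 image_Suc_atLeastAtMost)
  have "{(k, l) \<in> {1..n + 1} \<times> {1..n + 1}.
             int (descents (n + 1) (insertion k l \<pi>)) - int (descents n \<pi>) = a \<and>
             int (descents (n + 1) (inv (insertion k l \<pi>))) - int (descents n (inv \<pi>)) = b}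
        = map_prod Suc Suc ` C"
    unfolding cells C_def using gain by force
  then have "insertion_count n a b \<pi> = card C"
    unfolding insertion_count_def by (simp add: card_image prod.inj_map inj_on_subset[of _ UNIV])
  moreover have "int (card C) =
      (\<Sum>(j, m)\<in>{..n} \<times> {..n}. of_bool (descent_gain \<pi> j m = a \<and> descent_gain (inv \<pi>) m j = b))"
    by (auto simp: C_def case_prod_beta Int_def intro!: arg_cong[where f = card])
  ultimately show ?thesis
    by (simp add: sum.cartesian_product del: sum_of_bool_eq)
qed

lemma sum_step_telescope:
  fixes \<sigma> :: "nat \<Rightarrow> nat"
  assumes "\<sigma> 0 = 0"
  shows "(\<Sum>i<N. of_bool (m < \<sigma> (Suc i)) - of_bool (m < \<sigma> i)) = (of_bool (m < \<sigma> N) :: int)"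
  using assms by (subst sum_lessThan_telescope) simp

text \<open>Of the \<open>n + 1\<close> ones, one per \<open>j\<close>, the descents are removed,
  and one more is lost as \<open>m < \<pi> j\<close> climbs from false at \<open>j = 0\<close> to
  true at \<open>j = Suc n\<close>.\<close>

lemma sum_descent_gain:
  assumes p: "\<pi> permutes {1..n}" and "m \<le> n"
  shows "(\<Sum>j\<le>n. descent_gain \<pi> j m) = int n - int (descents n \<pi>)"
proof -
  have "\<pi> 0 = 0" "\<pi> (Suc n) = Suc n"
    using permutes_not_in[OF p] by auto
  then show ?thesis
    using sum_step_telescope[of \<pi> m "Suc n"] assms(2)
    by (simp add: descent_gain_def sum_subtractf descents_eq_sum[OF p] lessThan_Suc_atMost
        del: sum.lessThan_Suc sum_of_bool_eq)
qed

lemma sum_step_mult_step: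
  assumes p: "\<pi> permutes {1..n}" and j: "j \<le> n"
  shows "(\<Sum>m\<le>n. (of_bool (m < \<pi> (Suc j)) - of_bool (m < \<pi> j)) *
            (of_bool (j < inv \<pi> (Suc m)) - of_bool (j < inv \<pi> m))) = (1 :: int)"
proof -
  let ?c = "\<lambda>m. of_bool (j < inv \<pi> (Suc m)) - of_bool (j < inv \<pi> m) :: int"
  \<comment> \<open>The factor \<open>m < \<pi> i\<close> cuts the sum off at
    \<open>\<pi> i\<close>, where telescoping leaves \<open>j < inv \<pi> (\<pi> i) = i\<close>. The
    cases \<open>i = Suc j\<close> and \<open>i = j\<close> then give 1 and 0.\<close>
  have *: "(\<Sum>m\<le>n. of_bool (m < \<pi> i) * ?c m) = of_bool (j < i)" if "i \<le> Suc n" for i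
  proof -
    have "\<pi> i \<le> Suc n"
      using that permutes_in_image[OF p, of i] permutes_not_in[OF p, of i]
      by (cases "i \<in> {1..n}") auto
    then have "(\<Sum>m\<le>n. of_bool (m < \<pi> i) * ?c m) = (\<Sum>m<\<pi> i. ?c m)"
      by (intro sum.mono_neutral_cong_right) auto
    also have "\<dots> = of_bool (j < i)"
      using permutes_not_in[OF permutes_inv[OF p], of 0]
      by (subst sum_step_telescope) (simp_all add: permutes_inverses[OF p])
    finally show ?thesis .
  qed
  show ?thesis
    using *[of j] *[of "Suc j"] j by (simp only: left_diff_distrib sum_subtractf) simp
qed

lemma sum_descent_gain_mult:
  assumes p: "\<pi> permutes {1..n}"
  shows "(\<Sum>j\<le>n. \<Sum>m\<le>n. descent_gain \<pi> j m * descent_gain (inv \<pi>) m j)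
           = (int n - int (descents n \<pi>)) * (int n - int (descents n (inv \<pi>))) + int n"
proof -
  define u where "u \<sigma> j = (1 - of_bool (\<sigma> j > \<sigma> (Suc j)) :: int)" for \<sigma> :: "nat \<Rightarrow> nat" and j
  define v where "v \<sigma> j m = (of_bool (m < \<sigma> (Suc j)) - of_bool (m < \<sigma> j) :: int)"
    for \<sigma> :: "nat \<Rightarrow> nat" and j m
  have gain: "descent_gain \<sigma> j m = u \<sigma> j - v \<sigma> j m" for \<sigma> j m
    by (simp add: descent_gain_def u_def v_def)
  have u: "(\<Sum>j\<le>n. u \<sigma> j) = int n + 1 - int (descents n \<sigma>)" if "\<sigma> permutes {1..n}" for \<sigma>
    by (simp add: u_def sum_subtractf descents_eq_sum[OF that] del: sum_of_bool_eq)
  have v: "(\<Sum>j\<le>n. v \<sigma> j m) = 1" if "\<sigma> permutes {1..n}" "m \<le> n" for \<sigma> m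
    using sum_descent_gain[OF that] u[OF that(1)] by (simp add: gain sum_subtractf)
  note q = permutes_inv[OF p]
  \<comment> \<open>Expanding the product leaves \<open>u \<pi> j\<close> constant in
    \<open>m\<close>, while the sum of \<open>v (inv \<pi>) m j\<close> and the sum of the products
    of two steps are both 1.\<close>
  have "(\<Sum>m\<le>n. descent_gain \<pi> j m * descent_gain (inv \<pi>) m j)
      = u \<pi> j * (\<Sum>m\<le>n. u (inv \<pi>) m) - u \<pi> j - (\<Sum>m\<le>n. u (inv \<pi>) m * v \<pi> j m) + 1"
    if "j \<le> n" for j
  proof -
    have "(\<Sum>m\<le>n. descent_gain \<pi> j m * descent_gain (inv \<pi>) m j)
        = u \<pi> j * (\<Sum>m\<le>n. u (inv \<pi>) m) - u \<pi> j * (\<Sum>m\<le>n. v (inv \<pi>) m j)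
          - (\<Sum>m\<le>n. u (inv \<pi>) m * v \<pi> j m) + (\<Sum>m\<le>n. v \<pi> j m * v (inv \<pi>) m j)"
      by (simp add: gain sum_distrib_left algebra_simps flip: sum.distrib sum_subtractf)
    then show ?thesis
      using v[OF q that] sum_step_mult_step[OF p that] by (simp add: v_def)
  qed
  then have "(\<Sum>j\<le>n. \<Sum>m\<le>n. descent_gain \<pi> j m * descent_gain (inv \<pi>) m j)
      = (\<Sum>j\<le>n. u \<pi> j * (\<Sum>m\<le>n. u (inv \<pi>) m) - u \<pi> j - (\<Sum>m\<le>n. u (inv \<pi>) m * v \<pi> j m) + 1)"
    by simp
  also have "\<dots> = (\<Sum>j\<le>n. u \<pi> j) * (\<Sum>m\<le>n. u (inv \<pi>) m) - (\<Sum>j\<le>n. u \<pi> j)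
      - (\<Sum>j\<le>n. \<Sum>m\<le>n. u (inv \<pi>) m * v \<pi> j m) + (int n + 1)"
    by (simp add: sum.distrib sum_subtractf sum_distrib_right)
  also have "(\<Sum>j\<le>n. \<Sum>m\<le>n. u (inv \<pi>) m * v \<pi> j m) = (\<Sum>m\<le>n. u (inv \<pi>) m * (\<Sum>j\<le>n. v \<pi> j m))"
    by (subst sum.swap) (simp add: sum_distrib_left)
  also have "\<dots> = (\<Sum>m\<le>n. u (inv \<pi>) m)"
    using v[OF p] by simp
  \<comment> \<open>With \<open>U\<close> and \<open>U'\<close> the two sums of \<open>u\<close>,
    the total is \<open>U * U' - U - U' + n + 1 = (U - 1) * (U' - 1) + n\<close>.\<close>
  finally show ?thesis
    by (simp add: u[OF p] u[OF q] algebra_simps)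
qed

theorem theorem2p1:
  fixes n :: nat and \<pi> :: "nat \<Rightarrow> nat"
  assumes "n \<ge> 1" and "\<pi> permutes {1..n}"
  shows "let D = int (descents n \<pi>); D' = int (descents n (inv \<pi>)) in
      int (insertion_count n 1 1 \<pi>) = (int n - D) * (int n - D') + int n \<and>
      int (insertion_count n 1 0 \<pi>) = (int n - D) * (D' + 1) - int n \<and>
      int (insertion_count n 0 1 \<pi>) = (D + 1) * (int n - D') - int n \<and>
      int (insertion_count n 0 0 \<pi>) = (D + 1) * (D' + 1) + int n"
proof -
  note p = assms(2)
  define X where "X = descent_gain \<pi>"
  define Y where "Y j m = descent_gain (inv \<pi>) m j" for j m
  define D where "D = int (descents n \<pi>)"
  define D' where "D' = int (descents n (inv \<pi>))"
  have XY: "X j m = 0 \<or> X j m = 1" "Y j m = 0 \<or> Y j m = 1" for j m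
    using descent_gain_cases by (auto simp: X_def Y_def)
  \<comment> \<open>\<open>X\<close> telescopes along \<open>j\<close> and \<open>Y\<close> along
    \<open>m\<close>, so only here is the order of summation swapped.\<close>
  have sumX: "(\<Sum>j\<le>n. \<Sum>m\<le>n. X j m) = (int n + 1) * (int n - D)"
    by (subst sum.swap) (simp add: X_def D_def sum_descent_gain[OF p])
  have sumY: "(\<Sum>j\<le>n. \<Sum>m\<le>n. Y j m) = (int n + 1) * (int n - D')"
    by (simp add: Y_def D'_def sum_descent_gain[OF permutes_inv[OF p]])
  have sumXY: "(\<Sum>j\<le>n. \<Sum>m\<le>n. X j m * Y j m) = (int n - D) * (int n - D') + int n"
    using sum_descent_gain_mult[OF p] by (simp add: X_def Y_def D_def D'_def)
  have count: "int (insertion_count n a b \<pi>) = (\<Sum>j\<le>n. \<Sum>m\<le>n. of_bool (X j m = a \<and> Y j m = b))" for a b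
    using insertion_count_eq_sum[OF p] by (simp add: X_def Y_def)
  \<comment> \<open>On values in {0, 1} the indicators are polynomials in \<open>X\<close> and
    \<open>Y\<close>, so the three sums above and the number of cells determine all four
    counts.\<close>
  have bool: "of_bool (X j m = 1 \<and> Y j m = 1) = X j m * Y j m"
       "of_bool (X j m = 1 \<and> Y j m = 0) = X j m - X j m * Y j m"
       "of_bool (X j m = 0 \<and> Y j m = 1) = Y j m - X j m * Y j m"
       "of_bool (X j m = 0 \<and> Y j m = 0) = 1 - X j m - Y j m + X j m * Y j m" for j m
    using XY[of j m] by auto
  show ?thesis
    unfolding Let_def count bool D_def[symmetric] D'_def[symmetric]
    by (simp add: sum.distrib sum_subtractf sumX sumY sumXY) (simp add: algebra_simps)
qed

end
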